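(* Let $0<k<n$ and let $(u),(w)\in C_{k,n}$. The simplices $\Delta_{(u)}$ and $\Delta_{(w)}$ share a common facet if and only if there is a representative $u=u_1\cdots u_n$ of the cycle $(u)$ and an index $i\in[n]$ (with $u_{n+1}:=u_1$) such that $u_i-u_{i+1}\not\equiv\pm1\pmod n$ and $(w)=(u_i,u_{i+1})\,(u)\,(u_i,u_{i+1})$, i.e. $(w)$ is obtained from $(u)$ by switching the entries $u_i$ and $u_{i+1}$.
   Context: $\epsilon_I\in\mathbb{R}^n$ is the 0/1 indicator vector of $I\subseteq[n]$. The directed graph $G_{k,n}$ has vertices $\epsilon_I$ for $|I|=k$; indices are read mod $n$; there is an edge $\epsilon\xrightarrow{i}\epsilon'$ labelled $i\in[n]$ when $(\epsilon_i,\epsilon_{i+1})=(1,0)$ and $\epsilon'$ is $\epsilon$ with $\epsilon_i,\epsilon_{i+1}$ swapped. A minimal circuit is a directed circuit of minimal length in $G_{k,n}$ (each ``1'' moves step by step to the position of the next ``1'' cyclically); it has length $n$ and its successive edge labels $w_1,\dots,w_n$ form a permutation of $[n]$, determined up to cyclic shift. For a permutation $w=w_1\cdots w_n$, $(w)=(w_1,\dots,w_n)$ denotes the corresponding long cycle in $S_n$ (cycle notation). $C_{k,n}$ is the set of long cycles $(w)=(w_1,\dots,w_{n-1},n)$ such that $w^{-1}$ has exactly $k-1$ descents (indices $j$ with $w^{-1}(j)>w^{-1}(j+1)$); these are exactly the cyclic label sequences of minimal circuits, and for $(w)\in C_{k,n}$, $c_{(w)}$ is the minimal circuit with edge labels $w_1,\dots,w_n$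 in order and $\Delta_{(w)}$ is the convex hull of its vertices. The simplices $\Delta_{(w)}$, $(w)\in C_{k,n}$, triangulate the hypersimplex $\mathrm{conv}\{\epsilon_I:|I|=k\}$. *)

theory Defs
  imports "HOL-Analysis.Analysis" "HOL-Combinatorics.Cycles" "HOL-Number_Theory.Cong"
begin

text \<open>
  Throughout, \<open>e :: nat \<Rightarrow> 'n\<close> is meant to be a bijection from \<open>{1..n}\<close> onto the finite index
  type \<open>'n\<close>: it numbers the coordinates of \<open>real ^ 'n\<close> by \<open>1, \<dots>, n\<close>, so that the
  \<open>i\<close>-th coordinate of \<open>x\<close> is \<open>x $ e i\<close>.
\<close>

definition cyc_next :: "nat \<Rightarrow> nat \<Rightarrow> nat" where
  \<comment> \<open>\<open>i + 1\<close> read modulo \<open>n\<close> with representatives \<open>1, \<dots>, n\<close>\<close>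
  "cyc_next n i = i mod n + 1"

definition eps :: "(nat \<Rightarrow> 'n::finite) \<Rightarrow> nat set \<Rightarrow> real ^ 'n" where
  "eps e I = (\<chi> j. if j \<in> e ` I then 1 else 0)"

definition G_verts :: "(nat \<Rightarrow> 'n::finite) \<Rightarrow> nat \<Rightarrow> nat \<Rightarrow> (real ^ 'n) set" where
  "G_verts e k n = {eps e I | I. I \<subseteq> {1..n} \<and> card I = k}"

definition G_edge ::
  "(nat \<Rightarrow> 'n::finite) \<Rightarrow> nat \<Rightarrow> nat \<Rightarrow> real ^ 'n \<Rightarrow> nat \<Rightarrow> real ^ 'n \<Rightarrow> bool" where
  "G_edge e k n x i y \<longleftrightarrow>
     x \<in> G_verts e k n \<and> y \<in> G_verts e k n \<and> i \<in> {1..n} \<and>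
     x $ e i = 1 \<and> x $ e (cyc_next n i) = 0 \<and>
     y = (\<chi> j. x $ Transposition.transpose (e i) (e (cyc_next n i)) j)"

text \<open>
  A directed circuit is given by its list of vertices \<open>vs\<close> and its list of edge labels \<open>ls\<close>; the
  edge labelled \<open>ls ! j\<close> leaves \<open>vs ! j\<close>, and the last edge returns to \<open>vs ! 0\<close>.
\<close>

definition circuit ::
  "(nat \<Rightarrow> 'n::finite) \<Rightarrow> nat \<Rightarrow> nat \<Rightarrow> (real ^ 'n) list \<Rightarrow> nat list \<Rightarrow> bool" where
  "circuit e k n vs ls \<longleftrightarrow>
     vs \<noteq> [] \<and> length ls = length vs \<and>
     (\<forall>j < length vs. G_edge e k n (vs ! j) (ls ! j) (vs ! (Suc j mod length vs)))"

definition minimal_circuit ::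
  "(nat \<Rightarrow> 'n::finite) \<Rightarrow> nat \<Rightarrow> nat \<Rightarrow> (real ^ 'n) list \<Rightarrow> nat list \<Rightarrow> bool" where
  "minimal_circuit e k n vs ls \<longleftrightarrow>
     circuit e k n vs ls \<and>
     (\<forall>vs' ls'. circuit e k n vs' ls' \<longrightarrow> length vs \<le> length vs')"

definition word :: "nat \<Rightarrow> (nat \<Rightarrow> nat) \<Rightarrow> nat list" where
  "word n w = map w [1..<n + 1]"

definition long_cycle :: "nat \<Rightarrow> (nat \<Rightarrow> nat) \<Rightarrow> nat \<Rightarrow> nat" where
  "long_cycle n w = cycle_of_list (word n w)"

definition descents :: "nat \<Rightarrow> (nat \<Rightarrow> nat) \<Rightarrow> nat set" where
  "descents n p = {j \<in> {1..<n}. p j > p (j + 1)}"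

definition C_set :: "nat \<Rightarrow> nat \<Rightarrow> (nat \<Rightarrow> nat) set" where
  "C_set k n =
     {long_cycle n w | w. w permutes {1..n} \<and> w n = n \<and> card (descents n (inv w)) = k - 1}"

text \<open>
  The representative of \<open>c\<close> is normalised to end in \<open>n\<close>, which fixes the starting point of the
  vertex list; other representatives give cyclic shifts of the same circuit.
\<close>

definition circuit_of ::
  "(nat \<Rightarrow> 'n::finite) \<Rightarrow> nat \<Rightarrow> nat \<Rightarrow> (nat \<Rightarrow> nat) \<Rightarrow> (real ^ 'n) list" where
  "circuit_of e k n c =
     (THE vs. \<exists>w. w permutes {1..n} \<and> w n = n \<and> long_cycle n w = c \<and>
                  minimal_circuit e k n vs (word n w))"

definition Delta ::
  "(nat \<Rightarrow> 'n::finite) \<Rightarrow> nat \<Rightarrow> nat \<Rightarrow> (nat \<Rightarrow> nat) \<Rightarrow> (real ^ 'n) set" where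
  "Delta e k n c = convex hull (set (circuit_of e k n c))"

text \<open>
  Sharing a facet is a relation between two different simplices: a simplex is not regarded as
  sharing a facet with itself.
\<close>

definition share_common_facet :: "'a::euclidean_space set \<Rightarrow> 'a set \<Rightarrow> bool" where
  "share_common_facet S T \<longleftrightarrow> S \<noteq> T \<and> (\<exists>F. F facet_of S \<and> F facet_of T)"

end

theory Submission imports Defs begin

text \<open>
  Along a minimal circuit with cycle \<open>c\<close>, the vertex \<open>X a\<close> at which label \<open>a\<close> departs satisfies
  \<open>X (c a) = X a + step a\<close> with \<open>step a = \<epsilon>\<^sub>a\<^sub>+\<^sub>1 - \<epsilon>\<^sub>a\<close>.  The only linear relation between the steps is
  that they sum to zero, so the vertices of a circuit are affinely independent, and its facets are
  obtained by omitting one vertex.  Affine independence also shows that two consecutive vertices of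
  one circuit that both lie on another circuit are consecutive there, with the same label.  Hence
  a circuit that shares all vertices but \<open>X p\<close> with \<open>X\<close> agrees with it except that the two labels
  around \<open>X p\<close> are exchanged; as both labels can then depart from the same vertex, they are not
  cyclic neighbours.  Conversely, exchanging two such labels moves only the vertex between them.
\<close>

section \<open>The cyclic successor on \<open>{1..n}\<close>\<close>

lemma cyc_next_in: "i \<in> {1..n} \<Longrightarrow> cyc_next n i \<in> {1..n}"
  by (auto simp: cyc_next_def Suc_le_eq)

lemma cyc_next_less: "i < n \<Longrightarrow> cyc_next n i = Suc i"
  by (simp add: cyc_next_def)

lemma cyc_next_self: "cyc_next n n = 1"
  by (simp add: cyc_next_def)

lemma cyc_next_neq: "2 \<le> n \<Longrightarrow> i \<in> {1..n} \<Longrightarrow> cyc_next n i \<noteq> i"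
  by (cases "i = n") (auto simp: cyc_next_less cyc_next_self)

lemma inj_on_cyc_next: "inj_on (cyc_next n) {1..n}"
proof (rule inj_onI)
  fix i j assume "i \<in> {1..n}" "j \<in> {1..n}" "cyc_next n i = cyc_next n j"
  then show "i = j"
    by (cases "i = n"; cases "j = n") (auto simp: cyc_next_less cyc_next_self)
qed

lemma cyc_next_eq_iff:
  "i \<in> {1..n} \<Longrightarrow> j \<in> {1..n} \<Longrightarrow> cyc_next n i = cyc_next n j \<longleftrightarrow> i = j"
  by (rule inj_on_eq_iff[OF inj_on_cyc_next])

lemma cyc_next_image: "cyc_next n ` {1..n} = {1..n}"
  by (rule endo_inj_surj[OF finite_atLeastAtMost image_subsetI inj_on_cyc_next]) (rule cyc_next_in)

text \<open>The successor acts transitively on \<open>{1..n}\<close>. For boolean-valued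
  \<open>f\<close> this says that an invariant subset is empty or everything, which is how it is
  often applied below.\<close>

lemma cyc_next_invariant_const:
  assumes inv: "\<And>i. i \<in> {1..n} \<Longrightarrow> f (cyc_next n i) = f i"
    and "i \<in> {1..n}" "j \<in> {1..n}"
  shows "f i = f j"
proof -
  have "f i = f 1" if "1 \<le> i" "i \<le> n" for i
    using that
  proof (induction i rule: dec_induct)
    case (step m)
    then show ?case using inv[of m] by (simp add: cyc_next_less)
  qed simp
  from this[of i] this[of j] show ?thesis using assms(2,3) by simp
qed

text \<open>Translates the congruences of the theorem into the successor relation on labels used
  everywhere else.\<close>

lemma cong_one_iff_cyc_next:
  assumes "a \<in> {1..n}" "b \<in> {1..n}"
  shows "[int a - int b = 1] (mod int n) \<longleftrightarrow> a = cyc_next n b"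
proof -
  have "[int a - int b = 1] (mod int n) \<longleftrightarrow> [int a = int (cyc_next n b)] (mod int n)"
  proof (cases "b = n")
    case True
    have "int n dvd int a - 1 - int n \<longleftrightarrow> int n dvd int a - 1"
      using dvd_diff_right_iff[of "int n" "int n" "int a - 1"] dvd_minus_iff[of "int n" "int a - 1 - int n"] by simp
    then show ?thesis using True by (simp add: cong_iff_dvd_diff cyc_next_self algebra_simps)
  next
    case False
    then show ?thesis using assms by (simp add: cong_iff_dvd_diff cyc_next_less algebra_simps)
  qed
  also have "\<dots> \<longleftrightarrow> [a = cyc_next n b] (mod n)"
    by (simp add: cong_int_iff)
  also have "\<dots> \<longleftrightarrow> a = cyc_next n b"
  proof
    assume c: "[a = cyc_next n b] (mod n)"
    have "cyc_next n b \<in> {1..n}" by (rule cyc_next_in) fact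
    \<comment> \<open>Lowering both sides by 1 moves the representatives from \<open>1..n\<close> to
      \<open>0..n-1\<close>, where congruent numbers are equal.\<close>
    then have "[a - 1 = cyc_next n b - 1] (mod n)"
      using c assms by (metis atLeastAtMost_iff cong_diff_nat cong_refl)
    then show "a = cyc_next n b"
      using assms \<open>cyc_next n b \<in> {1..n}\<close> cong_less_modulus_unique_nat[of "a - 1" "cyc_next n b - 1" n]
      by simp linarith
  qed simp
  finally show ?thesis .
qed

lemma cong_minus_one_iff_cyc_next:
  assumes "a \<in> {1..n}" "b \<in> {1..n}"
  shows "[int a - int b = - 1] (mod int n) \<longleftrightarrow> b = cyc_next n a"
proof -
  have "[int a - int b = - 1] (mod int n) \<longleftrightarrow> [int b - int a = 1] (mod int n)"
    by (metis cong_minus_minus_iff minus_diff_eq)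
  then show ?thesis using cong_one_iff_cyc_next[OF assms(2,1)] by simp
qed

section \<open>Words and their long cycles\<close>

lemma length_word: "length (word n v) = n"
  by (simp add: word_def)

lemma nth_word: "j < n \<Longrightarrow> word n v ! j = v (Suc j)"
  by (simp add: word_def del: upt_Suc)

lemma distinct_word: "v permutes {1..n} \<Longrightarrow> distinct (word n v)"
  by (auto simp: word_def distinct_map intro: permutes_inj_on)

lemma set_word:
  assumes "v permutes {1..n}" shows "set (word n v) = {1..n}"
proof -
  have "{1..<n + 1} = {1..n}" by auto
  then show ?thesis using permutes_image[OF assms] by (simp add: word_def del: upt_Suc)
qed

lemma long_cycle_apply:
  assumes "v permutes {1..n}" "i \<in> {1..n}"
  shows "long_cycle n v (v i) = v (cyc_next n i)"
proof -
  let ?cs = "word n v"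
  \<comment> \<open>Applied entrywise to its own word, the cycle rotates it by one place; the letter
    \<open>v i\<close> stands at list index \<open>i - 1\<close>.\<close>
  have "map (cycle_of_list ?cs) ?cs ! (i - 1) = rotate1 ?cs ! (i - 1)"
    using cyclic_rotation[OF distinct_word[OF assms(1)], of 1] by simp
  moreover have "Suc (i - 1) = i" "i - 1 < n" "i mod n < n" using assms(2) by auto
  ultimately show ?thesis
    by (simp add: nth_rotate1 length_word nth_word long_cycle_def cyc_next_def)
qed

lemma long_cycle_permutes:
  assumes "v permutes {1..n}" shows "long_cycle n v permutes {1..n}"
  using cycle_permutes[of "word n v"] set_word[OF assms] by (simp add: long_cycle_def)

text \<open>\<open>v\<close> carries the successor on positions to the cycle on labels, so the cycle
  is transitive as well.\<close>

lemma long_cycle_invariant_const: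
  assumes v: "v permutes {1..n}"
    and inv: "\<And>a. a \<in> {1..n} \<Longrightarrow> f (long_cycle n v a) = f a"
    and "a \<in> {1..n}" "b \<in> {1..n}"
  shows "f a = f b"
proof -
  have "(f \<circ> v) (cyc_next n i) = (f \<circ> v) i" if "i \<in> {1..n}" for i
    using inv[of "v i"] long_cycle_apply[OF v that] permutes_in_image[OF v, of i] that by simp
  then have "(f \<circ> v) (inv v a) = (f \<circ> v) (inv v b)"
    by (rule cyc_next_invariant_const)
      (use assms permutes_in_image[OF permutes_inv[OF v]] in auto)
  then show ?thesis by (simp add: permutes_inverses(1)[OF v])
qed

text \<open>A fixed point would form an invariant singleton, which by transitivity would be all of
  \<open>{1..n}\<close>.\<close>

lemma long_cycle_neq:
  assumes "v permutes {1..n}" "2 \<le> n" "a \<in> {1..n}"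
  shows "long_cycle n v a \<noteq> a"
proof
  assume fixed: "long_cycle n v a = a"
  have "long_cycle n v b \<noteq> a" if "b \<noteq> a" for b
    using fixed that permutes_inj[OF long_cycle_permutes[OF assms(1)]] by (metis injD)
  then have "(long_cycle n v b = a) = (b = a)" for b
    using fixed by auto
  then have "(b = a) = (a = a)" if "b \<in> {1..n}" for b
    by (rule long_cycle_invariant_const[OF assms(1) _ that assms(3)])
  then have "{1..n} \<subseteq> {a}" by auto
  then show False using card_mono[of "{a}" "{1..n}"] assms(2) by simp
qed

text \<open>The set of positions where \<open>v\<close> and \<open>w\<close> agree is invariant
  under the successor, so a single agreement spreads everywhere. This pins down the representative
  ending in \<open>n\<close>.\<close>

lemma long_cycle_inject:
  assumes v: "v permutes {1..n}" and w: "w permutes {1..n}" and "0 < n"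
    and "long_cycle n v = long_cycle n w" and "v n = w n"
  shows "v = w"
proof -
  have "(v (cyc_next n i) = w (cyc_next n i)) = (v i = w i)" if "i \<in> {1..n}" for i
    using assms(4) long_cycle_apply[OF v that] long_cycle_apply[OF w that]
      permutes_inj[OF long_cycle_permutes[OF v]] by (metis injD)
  then have "(v i = w i) = (v n = w n)" if "i \<in> {1..n}" for i
    by (rule cyc_next_invariant_const) (use that \<open>0 < n\<close> in auto)
  then have "v i = w i" for i
    using assms(5) permutes_not_in[OF v] permutes_not_in[OF w] by (cases "i \<in> {1..n}") auto
  then show ?thesis by auto
qed

section \<open>Labelled circuits and the affine independence of their vertices\<close>

definition step :: "(nat \<Rightarrow> 'n::finite) \<Rightarrow> nat \<Rightarrow> nat \<Rightarrow> real ^ 'n" where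
  "step e n a = axis (e (cyc_next n a)) 1 - axis (e a) 1"

text \<open>
  A minimal circuit is indexed by its labels instead of by time: \<open>X a\<close> is the vertex from which
  the edge labelled \<open>a\<close> departs, so the next vertex on the circuit is \<open>X (c a)\<close>.
\<close>

definition labelled_circuit ::
  "(nat \<Rightarrow> 'n::finite) \<Rightarrow> nat \<Rightarrow> (nat \<Rightarrow> nat) \<Rightarrow> (nat \<Rightarrow> real ^ 'n) \<Rightarrow> bool" where
  "labelled_circuit e n c X \<longleftrightarrow>
     (\<forall>a\<in>{1..n}. X (c a) = X a + step e n a \<and> X a $ e a = 1 \<and> X a $ e (cyc_next n a) = 0)"

locale numbered_coordinates =
  fixes e :: "nat \<Rightarrow> 'n::finite" and n :: nat
  assumes bij: "bij_betw e {1..n} UNIV" and two_le: "2 \<le> n"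
begin

lemma e_eq_iff: "a \<in> {1..n} \<Longrightarrow> b \<in> {1..n} \<Longrightarrow> e a = e b \<longleftrightarrow> a = b"
  by (rule inj_on_eq_iff[OF bij_betw_imp_inj_on[OF bij]])

lemma coord_cases: obtains b where "b \<in> {1..n}" "j = e b"
  using bij by (metis UNIV_I bij_betw_imp_surj_on imageE)

lemma step_nth:
  assumes "a \<in> {1..n}" "b \<in> {1..n}"
  shows "step e n a $ e b = (if cyc_next n a = b then 1 else 0) - (if a = b then 1 else 0)"
  unfolding step_def axis_def vector_minus_component vec_lambda_beta
    e_eq_iff[OF assms(2) cyc_next_in[OF assms(1)]] e_eq_iff[OF assms(2,1)]
  by (simp only: eq_commute[of b])

text \<open>Only two steps touch coordinate \<open>cyc_next n i\<close>: that of \<open>i\<close>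
  raises it and that of \<open>cyc_next n i\<close> lowers it. Reading the relation there equates
  neighbouring coefficients.\<close>

lemma sum_step_eq_0_imp_const:
  assumes "(\<Sum>a\<in>{1..n}. f a *\<^sub>R step e n a) = 0" "a \<in> {1..n}" "b \<in> {1..n}"
  shows "f a = f b"
proof -
  have "f (cyc_next n i) = f i" if i: "i \<in> {1..n}" for i
  proof -
    have next_in: "cyc_next n i \<in> {1..n}" by (rule cyc_next_in[OF i])
    have "0 = (\<Sum>a\<in>{1..n}. f a *\<^sub>R step e n a) $ e (cyc_next n i)"
      by (simp only: assms(1) zero_index)
    also have "\<dots> = (\<Sum>a\<in>{1..n}. f a * step e n a $ e (cyc_next n i))"
      by (simp add: sum_component)
    also have "\<dots> = (\<Sum>a\<in>{1..n}. (if a = i then f a else 0) - (if a = cyc_next n i then f a else 0))"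
      by (rule sum.cong) (auto simp: step_nth[OF _ next_in] cyc_next_eq_iff[OF _ i] simp del: atLeastAtMost_iff)
    also have "\<dots> = f i - f (cyc_next n i)"
      using i next_in by (simp add: sum_subtractf)
    finally show ?thesis by simp
  qed
  then show ?thesis by (rule cyc_next_invariant_const) (use assms in auto)
qed

text \<open>\<open>X - Y\<close> does not change along the cycle, hence is one constant vector. Its
  coordinate \<open>e b\<close> vanishes because \<open>X b\<close> and \<open>Y b\<close> both have
  a 1 there.\<close>

lemma labelled_circuit_unique:
  assumes v: "v permutes {1..n}"
    and X: "labelled_circuit e n (long_cycle n v) X"
    and Y: "labelled_circuit e n (long_cycle n v) Y"
    and a: "a \<in> {1..n}"
  shows "X a = Y a"
proof -
  have "X b - Y b = X a - Y a" if "b \<in> {1..n}" for b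
    by (rule long_cycle_invariant_const[OF v _ that a]) (use X Y in \<open>auto simp: labelled_circuit_def\<close>)
  then have "(X a - Y a) $ e b = (X b - Y b) $ e b" if "b \<in> {1..n}" for b
    using that by metis
  then have "(X a - Y a) $ e b = 0" if "b \<in> {1..n}" for b
    using that X Y by (simp add: labelled_circuit_def)
  then have "X a - Y a = 0"
    unfolding vec_eq_iff by (metis coord_cases zero_index)
  then show ?thesis by simp
qed

text \<open>Summation by parts turns a relation among the vertices into one among the steps, whose
  coefficients are the partial sums of \<open>g\<close>. These are then constant, and the last one
  is 0, so \<open>g\<close> vanishes.\<close>

lemma labelled_circuit_independent:
  assumes v: "v permutes {1..n}"
    and X: "labelled_circuit e n (long_cycle n v) X"
    and g0: "(\<Sum>a\<in>{1..n}. g a) = 0" and gX: "(\<Sum>a\<in>{1..n}. g a *\<^sub>R X a) = 0"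
    and a: "a \<in> {1..n}"
  shows "g a = 0"
proof -
  define G where "G m = (\<Sum>i\<in>{1..m}. g (v i))" for m
  \<comment> \<open>\<open>Y m\<close> is the vertex reached by the edge labelled
    \<open>v m\<close>; as \<open>cyc_next n 0 = 1\<close>, \<open>Y 0\<close> is the first vertex
    \<open>X (v 1)\<close>.\<close>
  define Y where "Y m = X (v (cyc_next n m))" for m
  have G_Suc: "G (Suc m) = G m + g (v (Suc m))" for m
    by (simp add: G_def)
  have v_in: "v i \<in> {1..n}" if "i \<in> {1..n}" for i
    using permutes_in_image[OF v] that by simp
  have Y_pred: "X (v (Suc m)) = Y m" if "m < n" for m
    using that by (simp add: Y_def cyc_next_less)
  have Y_Suc: "Y (Suc m) = Y m + step e n (v (Suc m))" if "m < n" for m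
  proof -
    have i: "Suc m \<in> {1..n}" using that by simp
    have "Y (Suc m) = X (long_cycle n v (v (Suc m)))"
      by (simp only: Y_def long_cycle_apply[OF v i])
    then show ?thesis
      using X v_in[OF i] Y_pred[OF that] by (simp add: labelled_circuit_def)
  qed
  have abel: "(\<Sum>i\<in>{1..m}. g (v i) *\<^sub>R X (v i))
      = G m *\<^sub>R Y m - (\<Sum>i\<in>{1..m}. G i *\<^sub>R step e n (v i))" if "m \<le> n" for m
    using that
  proof (induction m)
    case (Suc m)
    then show ?case
      by (simp add: Y_Suc Y_pred G_Suc algebra_simps)
  qed (simp add: G_def)
  have "G n = 0" using g0 sum.permute[OF v, of g] by (simp add: G_def o_def)
  moreover have "(\<Sum>i\<in>{1..n}. g (v i) *\<^sub>R X (v i)) = 0"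
    using gX sum.permute[OF v, of "\<lambda>a. g a *\<^sub>R X a"] by (simp add: o_def)
  ultimately have "(\<Sum>i\<in>{1..n}. G i *\<^sub>R step e n (v i)) = 0"
    using abel[of n] by simp
  \<comment> \<open>Reindexing from positions to labels brings the relation into the form required
    by \<open>sum_step_eq_0_imp_const\<close>.\<close>
  then have "(\<Sum>b\<in>{1..n}. G (inv v b) *\<^sub>R step e n b) = 0"
    using sum.permute[OF v, of "\<lambda>b. G (inv v b) *\<^sub>R step e n b"]
    by (simp add: o_def permutes_inverses(2)[OF v])
  then have "G (inv v (v i)) = G (inv v (v n))" if "i \<in> {1..n}" for i
    by (rule sum_step_eq_0_imp_const[OF _ v_in[OF that] v_in]) (use two_le in simp)
  then have "G i = 0" if "i \<in> {1..n}" for i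
    using that \<open>G n = 0\<close> by (simp only: permutes_inverses(2)[OF v])
  moreover have "G 0 = 0" by (simp add: G_def)
  ultimately have G0: "G i = 0" if "i \<le> n" for i
    using that by (cases "i = 0") auto
  have "inv v a \<in> {1..n}"
    using permutes_in_image[OF permutes_inv[OF v], of a] a by simp
  then obtain m where m: "inv v a = Suc m" "Suc m \<le> n"
    by (cases "inv v a") auto
  then have "g (v (Suc m)) = 0"
    using G_Suc[of m] G0[of m] G0[of "Suc m"] by simp
  then show ?thesis using m by (metis permutes_inverses(1)[OF v])
qed

text \<open>A coincidence of two vertices would be a relation with coefficients 1 and -1.\<close>

lemma labelled_circuit_inj_on:
  assumes v: "v permutes {1..n}" and X: "labelled_circuit e n (long_cycle n v) X"
  shows "inj_on X {1..n}"
proof (rule inj_onI, rule ccontr)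
  fix a b assume ab: "a \<in> {1..n}" "b \<in> {1..n}" "X a = X b" "a \<noteq> b"
  define g :: "nat \<Rightarrow> real" where "g i = (if i = a then 1 else 0) - (if i = b then 1 else 0)" for i
  have "(\<Sum>i\<in>{1..n}. g i) = 0"
    using ab by (simp add: g_def sum_subtractf)
  moreover have "(\<Sum>i\<in>{1..n}. g i *\<^sub>R X i)
      = (\<Sum>i\<in>{1..n}. (if i = a then X i else 0) - (if i = b then X i else 0))"
    by (rule sum.cong) (auto simp: g_def)
  then have "(\<Sum>i\<in>{1..n}. g i *\<^sub>R X i) = 0"
    using ab by (simp add: sum_subtractf)
  ultimately have "g a = 0"
    by (rule labelled_circuit_independent[OF v X _ _ ab(1)])
  then show False using ab(4) by (simp add: g_def)
qed

lemma labelled_circuit_affine_independent: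
  assumes v: "v permutes {1..n}" and X: "labelled_circuit e n (long_cycle n v) X"
  shows "\<not> affine_dependent (X ` {1..n})"
proof
  assume "affine_dependent (X ` {1..n})"
  then obtain U x where U: "sum U (X ` {1..n}) = 0" "x \<in> X ` {1..n}" "U x \<noteq> 0"
    "(\<Sum>x\<in>X ` {1..n}. U x *\<^sub>R x) = 0"
    by (auto simp: affine_dependent_explicit_finite)
  then obtain a where "a \<in> {1..n}" "x = X a" by auto
  then have "U (X a) = 0"
    using labelled_circuit_independent[OF v X, of "U \<circ> X" a] U(1,4)
    unfolding sum.reindex[OF labelled_circuit_inj_on[OF v X]] by (simp add: o_def)
  then show False using U(3) \<open>x = X a\<close> by simp
qed

text \<open>
  Both \<open>X (u a) - X a\<close> and \<open>Y (w a) - Y a\<close> equal \<open>step a\<close>; if \<open>X a = Y b\<close> and \<open>X (u a) = Y d\<close>,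
  then \<open>Y d + Y a = Y b + Y (w a)\<close>, which affine independence of \<open>Y\<close> only allows if \<open>b = a\<close>.
\<close>

lemma shared_edge:
  assumes X: "labelled_circuit e n u X" and w: "w permutes {1..n}"
    and Y: "labelled_circuit e n (long_cycle n w) Y"
    and a: "a \<in> {1..n}" and "X a \<in> Y ` {1..n}" "X (u a) \<in> Y ` {1..n}"
  shows "Y a = X a"
proof -
  let ?c = "long_cycle n w"
  obtain b d where b: "b \<in> {1..n}" "X a = Y b" and d: "d \<in> {1..n}" "X (u a) = Y d"
    using assms by auto
  have ca: "?c a \<in> {1..n}" using permutes_in_image[OF long_cycle_permutes[OF w]] a by simp
  have "X (u a) = X a + step e n a" "Y (?c a) = Y a + step e n a"
    using X Y a by (auto simp: labelled_circuit_def)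
  then have eq: "Y d - Y b = Y (?c a) - Y a"
    using b d by simp
  define g :: "nat \<Rightarrow> real" where "g i = (if i = d then 1 else 0) + (if i = a then 1 else 0)
    - (if i = b then 1 else 0) - (if i = ?c a then 1 else 0)" for i
  have "sum g {1..n} = 0"
    using a b d ca by (simp add: g_def sum_subtractf sum.distrib)
  have indicator: "(if P then 1 else 0) *\<^sub>R x = (if P then x else 0)"
    for P and x :: "real ^ 'n" by simp
  have "(\<Sum>i\<in>{1..n}. g i *\<^sub>R Y i)
      = (\<Sum>i\<in>{1..n}. (if i = d then Y i else 0) + (if i = a then Y i else 0)
          - (if i = b then Y i else 0) - (if i = ?c a then Y i else 0))"
    by (simp only: g_def scaleR_left_distrib scaleR_left_diff_distrib indicator)
  then have "(\<Sum>i\<in>{1..n}. g i *\<^sub>R Y i) = 0"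
    using a b d ca eq by (simp add: sum_subtractf sum.distrib algebra_simps)
  from labelled_circuit_independent[OF w Y \<open>sum g {1..n} = 0\<close> this a] have "g a = 0" .
  moreover have "?c a \<noteq> a" by (rule long_cycle_neq[OF w two_le a])
  \<comment> \<open>In \<open>g a\<close> the 1 contributed by \<open>i = a\<close> must be
    cancelled, and only the term for \<open>b\<close> can do so.\<close>
  ultimately have "a = b"
    by (auto simp: g_def split: if_splits)
  then show ?thesis using b by simp
qed

section \<open>Circuits of the graph: edges, length and existence\<close>

lemma G_edge_imp_step:
  assumes "G_edge e k n x i y"
  shows "y = x + step e n i"
proof -
  have i: "i \<in> {1..n}" using assms by (simp add: G_edge_def)
  have "e (cyc_next n i) \<noteq> e i"
    using e_eq_iff[OF cyc_next_in[OF i] i] cyc_next_neq[OF two_le i] by simp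
  then show ?thesis
    using assms by (auto simp: G_edge_def vec_eq_iff step_def axis_def Transposition.transpose_def)
qed

lemma eps_nth:
  assumes "I \<subseteq> {1..n}" "b \<in> {1..n}"
  shows "eps e I $ e b = (if b \<in> I then 1 else 0)"
proof -
  have "e b \<in> e ` I \<longleftrightarrow> b \<in> I"
    by (rule inj_on_image_mem_iff[OF bij_betw_imp_inj_on[OF bij] assms(2,1)])
  then show ?thesis by (simp add: eps_def)
qed

text \<open>Describes an edge by its effect on index sets, the form in which circuits are built in
  \<open>circuit_exists\<close>.\<close>

lemma G_edge_eps:
  assumes "I \<subseteq> {1..n}" "card I = k" "i \<in> I" "cyc_next n i \<notin> I"
  shows "G_edge e k n (eps e I) i (eps e (insert (cyc_next n i) (I - {i})))"
    (is "G_edge e k n _ i (eps e ?J)")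
proof -
  have i: "i \<in> {1..n}" using assms by auto
  have next_in: "cyc_next n i \<in> {1..n}" by (rule cyc_next_in[OF i])
  have J: "?J \<subseteq> {1..n}" using assms(1) next_in by auto
  have "finite I" using assms(1) finite_subset by blast
  then have "card ?J = k"
    using assms(2,3,4) by (metis DiffD1 card.remove card_insert_disjoint finite_Diff)
  have "eps e ?J $ j = eps e I $ Transposition.transpose (e i) (e (cyc_next n i)) j" for j
  proof -
    obtain b where b: "b \<in> {1..n}" "j = e b" by (rule coord_cases)
    note nth = eps_nth[OF J i] eps_nth[OF J next_in] eps_nth[OF assms(1) i]
      eps_nth[OF assms(1) next_in] eps_nth[OF J b(1)] eps_nth[OF assms(1) b(1)]
    consider "b = i" | "b = cyc_next n i" | "b \<noteq> i" "b \<noteq> cyc_next n i" by blast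
    then show ?thesis
    proof cases
      case 1
      then show ?thesis
        using assms(3,4) b cyc_next_neq[OF two_le i] nth by simp
    next
      case 2
      then show ?thesis
        using assms(3,4) b nth by simp
    next
      case 3
      then have "j \<noteq> e i" "j \<noteq> e (cyc_next n i)"
        using e_eq_iff[OF b(1) i] e_eq_iff[OF b(1) next_in] b(2) by auto
      then show ?thesis
        using 3 b nth by simp
    qed
  qed
  then have "eps e ?J = (\<chi> j. eps e I $ Transposition.transpose (e i) (e (cyc_next n i)) j)"
    by (simp only: vec_eq_iff vec_lambda_beta) simp
  moreover have "eps e I \<in> G_verts e k n" "eps e ?J \<in> G_verts e k n"
    using assms(1,2) J \<open>card ?J = k\<close> unfolding G_verts_def by blast+
  ultimately show ?thesis
    unfolding G_edge_def
    using assms(3,4) i eps_nth[OF assms(1) i] eps_nth[OF assms(1) next_in] by simp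
qed

text \<open>The steps around a circuit sum to zero, so all labels occur equally often. The first
  label occurs, hence all \<open>n\<close> labels do.\<close>

lemma circuit_length_ge:
  assumes "circuit e k n vs ls"
  shows "n \<le> length vs"
proof -
  define L where "L = length vs"
  have L: "L > 0" "length ls = L"
    and edge: "\<And>j. j < L \<Longrightarrow> G_edge e k n (vs ! j) (ls ! j) (vs ! (Suc j mod L))"
    using assms by (auto simp: circuit_def L_def)
  have ls_in: "ls ! j \<in> {1..n}" if "j < L" for j
    using edge[OF that] by (simp add: G_edge_def)
  \<comment> \<open>The number of occurrences of \<open>a\<close> among the labels, as a real
    coefficient.\<close>
  define m :: "nat \<Rightarrow> real" where "m a = (\<Sum>j<L. if ls ! j = a then 1 else 0)" for a
  have inj: "inj_on (\<lambda>j. Suc j mod L) {..<L}"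
  proof (rule inj_onI)
    fix i j assume "i \<in> {..<L}" "j \<in> {..<L}" "Suc i mod L = Suc j mod L"
    then show "i = j" by (auto simp: mod_Suc split: if_splits)
  qed
  have "(\<lambda>j. Suc j mod L) ` {..<L} = {..<L}"
    by (rule endo_inj_surj[OF _ _ inj]) (use L in auto)
  then have "(\<Sum>j<L. vs ! (Suc j mod L)) = (\<Sum>j<L. vs ! j)"
    using sum.reindex[OF inj, of "(!) vs"] by (simp add: o_def)
  moreover have "(\<Sum>j<L. vs ! (Suc j mod L)) = (\<Sum>j<L. vs ! j + step e n (ls ! j))"
    by (rule sum.cong) (auto simp: G_edge_imp_step[OF edge])
  ultimately have "0 = (\<Sum>j<L. step e n (ls ! j))"
    by (simp add: sum.distrib)
  also have "\<dots> = (\<Sum>j<L. \<Sum>a\<in>{1..n}. if a = ls ! j then step e n a else 0)"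
    by (rule sum.cong) (use ls_in in \<open>auto simp: sum.delta\<close>)
  also have "\<dots> = (\<Sum>a\<in>{1..n}. \<Sum>j<L. if a = ls ! j then step e n a else 0)"
    by (rule sum.swap)
  also have "\<dots> = (\<Sum>a\<in>{1..n}. m a *\<^sub>R step e n a)"
    by (rule sum.cong[OF refl], simp add: m_def scaleR_sum_left, rule sum.cong) auto
  finally have "(\<Sum>a\<in>{1..n}. m a *\<^sub>R step e n a) = 0" by simp
  then have const: "m a = m (ls ! 0)" if "a \<in> {1..n}" for a
    by (rule sum_step_eq_0_imp_const[OF _ that ls_in[OF L(1)]])
  \<comment> \<open>The left-hand condition is kept so that the bound is literally the summand at
    index 0.\<close>
  have "m (ls ! 0) \<ge> (if ls ! 0 = ls ! 0 then 1 else 0)"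
    unfolding m_def by (rule member_le_sum) (use L in auto)
  then have "m a \<noteq> 0" if "a \<in> {1..n}" for a
    using const[OF that] by simp
  then have "a \<in> set ls" if "a \<in> {1..n}" for a
    using that L(2) by (force simp: m_def in_set_conv_nth intro: sum.neutral)
  then have "{1..n} \<subseteq> set ls" by blast
  then have "card {1..n} \<le> card (set ls)"
    by (rule card_mono[rotated]) simp
  also have "\<dots> \<le> L" using card_length[of ls] L by simp
  finally show ?thesis by (simp add: L_def)
qed

text \<open>Label \<open>a\<close> is used at time \<open>inv v a\<close>; times start at 1 and list
  indices at 0.\<close>

lemma circuit_imp_labelled_circuit:
  assumes v: "v permutes {1..n}" and c: "circuit e k n vs (word n v)"
  shows "labelled_circuit e n (long_cycle n v) (\<lambda>a. vs ! (inv v a - 1))"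
proof -
  have len: "length vs = n" using c by (simp add: circuit_def length_word)
  have "vs ! (inv v (long_cycle n v a) - 1) = vs ! (inv v a - 1) + step e n a
      \<and> vs ! (inv v a - 1) $ e a = 1 \<and> vs ! (inv v a - 1) $ e (cyc_next n a) = 0"
    if a: "a \<in> {1..n}" for a
  proof -
    define i where "i = inv v a"
    have i: "i \<in> {1..n}" using permutes_in_image[OF permutes_inv[OF v]] a by (simp add: i_def)
    have a_eq: "a = v i" by (simp add: i_def permutes_inverses(1)[OF v])
    have "i - 1 < n" "Suc (i - 1) = i" using i by auto
    then have edge: "G_edge e k n (vs ! (i - 1)) a (vs ! (i mod n))"
      using c len a_eq by (auto simp: circuit_def nth_word dest: spec[of _ "i - 1"])
    have "inv v (long_cycle n v a) - 1 = i mod n"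
      using long_cycle_apply[OF v i] a_eq by (simp add: permutes_inverses(2)[OF v] cyc_next_def)
    then show ?thesis
      using G_edge_imp_step[OF edge] edge by (simp add: G_edge_def i_def)
  qed
  then show ?thesis by (simp add: labelled_circuit_def)
qed

text \<open>
  Coordinate \<open>b + 1\<close> of the vertex at time \<open>t\<close> is \<open>1\<close> iff the last of the labels \<open>b, b + 1\<close> used
  strictly before \<open>t\<close> (cyclically) is \<open>b\<close>.  At time \<open>1\<close> this holds iff \<open>b = n\<close> or \<open>b\<close> is a
  descent of \<open>inv w\<close>, which accounts for \<open>k\<close> ones.
\<close>

lemma circuit_exists:
  assumes w: "w permutes {1..n}" "w n = n"
    and k: "card (descents n (inv w)) = k - 1" "0 < k"
  obtains vs where "circuit e k n vs (word n w)"
proof -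
  define pos where "pos = inv w"
  have pos_in: "pos b \<in> {1..n}" if "b \<in> {1..n}" for b
    using permutes_in_image[OF permutes_inv[OF w(1)]] that by (simp add: pos_def)
  have pos_eq_iff: "pos b = pos c \<longleftrightarrow> b = c" for b c
    using permutes_inj[OF permutes_inv[OF w(1)]] by (auto simp: pos_def inj_def)
  have pos_n: "pos n = n"
    using permutes_inverses(2)[OF w(1), of n] w(2) by (simp add: pos_def)
  \<comment> \<open>The second branch is a time interval that wraps around. The bounds are strict on
    one side only because the state at time \<open>t\<close> is the one before label
    \<open>w t\<close> is used.\<close>
  define Q where "Q t b \<longleftrightarrow> (if pos b < pos (cyc_next n b)
    then pos b < t \<and> t \<le> pos (cyc_next n b) else t \<le> pos (cyc_next n b) \<or> pos b < t)" for t b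
  \<comment> \<open>The positions of the ones at time \<open>t\<close>.\<close>
  define I where "I t = cyc_next n ` {b \<in> {1..n}. Q t b}" for t
  have next_in_I: "cyc_next n b \<in> I t \<longleftrightarrow> Q t b" if "b \<in> {1..n}" for b t
    using that by (auto simp: I_def cyc_next_eq_iff simp del: atLeastAtMost_iff)
  have I_sub: "I t \<subseteq> {1..n}" for t
    using cyc_next_in by (auto simp: I_def simp del: atLeastAtMost_iff)
  have move: "w t \<in> I t" "cyc_next n (w t) \<notin> I t"
    "I (Suc t) = insert (cyc_next n (w t)) (I t - {w t})" if t: "t \<in> {1..n}" for t
  proof -
    define a where "a = w t"
    have a: "a \<in> {1..n}" using permutes_in_image[OF w(1)] t by (simp add: a_def)
    have pos_a: "pos a = t" by (simp add: a_def pos_def permutes_inverses(2)[OF w(1)])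
    then have pos_t: "pos b = t \<longleftrightarrow> b = a" for b using pos_eq_iff by metis
    have neq: "cyc_next n a \<noteq> a" by (rule cyc_next_neq[OF two_le a])
    show nexta: "cyc_next n (w t) \<notin> I t"
      using next_in_I[OF a] pos_a pos_eq_iff[of a "cyc_next n a"] neq by (auto simp: a_def[symmetric] Q_def)
    obtain p where p: "p \<in> {1..n}" "cyc_next n p = a"
      using a cyc_next_image[of n] by (metis imageE)
    show "w t \<in> I t"
      using next_in_I[OF p(1), of t] p(2) pos_a by (auto simp: a_def[symmetric] Q_def)
    \<comment> \<open>Between times \<open>t\<close> and \<open>t + 1\<close> only the label
      \<open>a\<close> is used: it fills the position after \<open>a\<close> and empties position
      \<open>a\<close>.\<close>
    have Q_Suc: "Q (Suc t) b \<longleftrightarrow> b = a \<or> Q t b \<and> cyc_next n b \<noteq> a" for b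
      using pos_t[of b] pos_t[of "cyc_next n b"] neq pos_a by (auto simp: Q_def)
    have "x \<in> I (Suc t) \<longleftrightarrow> x \<in> insert (cyc_next n a) (I t - {a})" if x: "x \<in> {1..n}" for x
    proof -
      obtain b where b: "b \<in> {1..n}" "x = cyc_next n b"
        using x cyc_next_image[of n] by (metis imageE)
      then show ?thesis
        using next_in_I[OF b(1)] Q_Suc[of b] neq cyc_next_eq_iff[OF b(1) a] by auto
    qed
    then show "I (Suc t) = insert (cyc_next n (w t)) (I t - {w t})"
      using I_sub cyc_next_in[OF a] unfolding a_def by blast
  qed
  have finI: "finite (I t)" for t using I_sub finite_subset by blast
  have card_I: "card (I t) = k" if "1 \<le> t" "t \<le> n" for t
    using that
  proof (induction t rule: dec_induct)
    case base
    have "{b \<in> {1..n}. Q 1 b} = insert n (descents n pos)"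
    proof -
      have "Q 1 b \<longleftrightarrow> b = n \<or> b \<in> descents n pos" if b: "b \<in> {1..n}" for b
      proof (cases "b = n")
        case True
        then show ?thesis using pos_n pos_in[OF cyc_next_in[OF b]] by (auto simp: Q_def)
      next
        case False
        then show ?thesis
          using b pos_in[OF b] pos_in[OF cyc_next_in[OF b]] pos_eq_iff[of b "Suc b"]
          by (auto simp: Q_def cyc_next_less descents_def)
      qed
      then show ?thesis using two_le by (auto simp: descents_def)
    qed
    moreover have "card (insert n (descents n pos)) = k"
      using k by (simp add: descents_def pos_def)
    moreover have "card (I 1) = card {b \<in> {1..n}. Q 1 b}"
      unfolding I_def by (rule card_image[OF inj_on_subset[OF inj_on_cyc_next]]) blast
    ultimately show ?case by simp
  next
    case (step t)
    then have t: "t \<in> {1..n}" by simp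
    show ?case
      using move[OF t] finI[of t] step by (metis DiffD1 Suc_leD card.remove card_insert_disjoint finite_Diff)
  qed
  \<comment> \<open>All values of \<open>pos\<close> lie in \<open>{1..n}\<close>, so time
    \<open>n + 1\<close> cannot be told from time 1 and the path closes up.\<close>
  have "Q (Suc n) b = Q 1 b" if "b \<in> {1..n}" for b
    using pos_in[OF that] pos_in[OF cyc_next_in[OF that]] by (auto simp: Q_def)
  then have I_wrap: "I (Suc n) = I 1" unfolding I_def by (metis (no_types, lifting))
  define vs where "vs = map (\<lambda>j. eps e (I (Suc j))) [0..<n]"
  have "G_edge e k n (vs ! j) (word n w ! j) (vs ! (Suc j mod n))" if j: "j < n" for j
  proof -
    have t: "Suc j \<in> {1..n}" using j by simp
    have "vs ! (Suc j mod n) = eps e (I (Suc (Suc j)))"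
      using j I_wrap by (cases "Suc j = n") (simp_all add: vs_def)
    then show ?thesis
      using G_edge_eps[OF I_sub card_I move(1)[OF t] move(2)[OF t]] move(3)[OF t] j
      by (simp add: vs_def nth_word)
  qed
  then have "circuit e k n vs (word n w)"
    using two_le by (auto simp: circuit_def vs_def length_word)
  then show ?thesis by (rule that)
qed

text \<open>Resolves the definite description in \<open>circuit_of\<close>. A circuit exists, it is
  minimal since it has \<open>n\<close> edges, and it is unique since the normalised word and then
  its vertices are determined by \<open>c\<close>.\<close>

lemma Delta_eq_hull_labelled_circuit:
  assumes "c \<in> C_set k n" "0 < k"
  obtains v X where "v permutes {1..n}" "c = long_cycle n v" "labelled_circuit e n c X"
    "Delta e k n c = convex hull (X ` {1..n})"
proof -
  obtain w where w: "w permutes {1..n}" "w n = n" "c = long_cycle n w"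
    "card (descents n (inv w)) = k - 1"
    using assms(1) by (auto simp: C_set_def)
  obtain vs where vs: "circuit e k n vs (word n w)"
    using circuit_exists[OF w(1,2,4) assms(2)] .
  have len: "length vs' = n" if "circuit e k n vs' (word n w)" for vs'
    using that by (simp add: circuit_def length_word)
  define X where "X a = vs ! (inv w a - 1)" for a
  have X: "labelled_circuit e n c X"
    using circuit_imp_labelled_circuit[OF w(1) vs] by (simp add: w(3) X_def[abs_def])
  have "circuit_of e k n c = vs"
    unfolding circuit_of_def
  proof (rule the_equality)
    show "\<exists>w. w permutes {1..n} \<and> w n = n \<and> long_cycle n w = c \<and> minimal_circuit e k n vs (word n w)"
      using w vs len[OF vs] circuit_length_ge by (auto simp: minimal_circuit_def)
  next
    fix vs'
    assume "\<exists>w. w permutes {1..n} \<and> w n = n \<and> long_cycle n w = c \<and> minimal_circuit e k n vs' (word n w)"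
    then obtain w' where w': "w' permutes {1..n}" "w' n = n" "long_cycle n w' = c"
      "circuit e k n vs' (word n w')"
      by (auto simp: minimal_circuit_def)
    have "w' = w"
      by (rule long_cycle_inject[OF w'(1) w(1)]) (use two_le w w' in auto)
    with w' have vs': "circuit e k n vs' (word n w)" by simp
    show "vs' = vs"
    proof (rule nth_equalityI)
      fix j assume "j < length vs'"
      then have "Suc j \<in> {1..n}" using len[OF vs'] by simp
      then have "w (Suc j) \<in> {1..n}" using permutes_in_image[OF w(1)] by simp
      from labelled_circuit_unique[OF w(1) circuit_imp_labelled_circuit[OF w(1) vs']
          circuit_imp_labelled_circuit[OF w(1) vs] this]
      show "vs' ! j = vs ! j" by (simp add: permutes_inverses(2)[OF w(1)])
    qed (simp add: len[OF vs] len[OF vs'])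
  qed
  moreover have "set vs = X ` {1..n}"
  proof -
    have "X ` {1..n} = X ` w ` {1..n}" by (simp only: permutes_image[OF w(1)])
    also have "\<dots> = (\<lambda>i. vs ! (i - 1)) ` {1..n}"
      by (simp only: image_image X_def permutes_inverses(2)[OF w(1)])
    also have "\<dots> = (\<lambda>i. vs ! (i - 1)) ` Suc ` {0..<n}"
      by (simp only: image_Suc_atLeastLessThan atLeastLessThanSuc_atLeastAtMost One_nat_def)
    also have "\<dots> = set vs"
      using nth_image[of n vs] len[OF vs] by (simp add: image_image atLeast0LessThan)
    finally show ?thesis by simp
  qed
  ultimately have "Delta e k n c = convex hull (X ` {1..n})"
    by (simp add: Delta_def)
  with that[OF w(1,3) X] show ?thesis .
qed

section \<open>Common facets and exchanged labels\<close>

text \<open>Around the omitted vertex \<open>X p\<close> the cycle \<open>u\<close> runs through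
  \<open>r, q, p, s\<close>, where \<open>s = r\<close> may happen. Shared edges force
  \<open>w\<close> to agree with \<open>u\<close> except at \<open>r\<close>, \<open>q\<close>,
  \<open>p\<close>, and since \<open>w \<noteq> u\<close> it must run through
  \<open>r, p, q, s\<close>.\<close>

lemma shared_facet_imp_swap:
  assumes v: "v permutes {1..n}" "u = long_cycle n v" and X: "labelled_circuit e n u X"
    and v': "v' permutes {1..n}" "w = long_cycle n v'" and Y: "labelled_circuit e n w Y"
    and "u \<noteq> w" and p: "p \<in> {1..n}"
    and facet: "X ` {1..n} - {X p} = Y ` {1..n} - {y}"
  obtains a where "a \<in> {1..n}" "u a \<noteq> cyc_next n a" "a \<noteq> cyc_next n (u a)"
    "w = Transposition.transpose a (u a) \<circ> u \<circ> Transposition.transpose a (u a)"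
proof -
  have u: "u permutes {1..n}" and w: "w permutes {1..n}"
    using long_cycle_permutes v v' by auto
  have u_in: "u a \<in> {1..n}" and w_in: "w a \<in> {1..n}" if "a \<in> {1..n}" for a
    using that by (simp_all only: permutes_in_image[OF u] permutes_in_image[OF w])
  have u_eq: "u a = u b \<longleftrightarrow> a = b" and w_eq: "w a = w b \<longleftrightarrow> a = b" for a b
    by (rule inj_eq[OF permutes_inj[OF u]], rule inj_eq[OF permutes_inj[OF w]])
  have u_neq: "u a \<noteq> a" and w_neq: "w a \<noteq> a" if "a \<in> {1..n}" for a
    using long_cycle_neq[OF v(1) two_le that] long_cycle_neq[OF v'(1) two_le that]
    by (simp_all only: v(2) v'(2) not_False_eq_True)
  have X_eq: "X a = X b \<longleftrightarrow> a = b" if "a \<in> {1..n}" "b \<in> {1..n}" for a b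
    by (rule inj_on_eq_iff[OF labelled_circuit_inj_on[OF v(1) X[unfolded v(2)]] that])
  have eqI: "w = f" if "\<And>a. a \<in> {1..n} \<Longrightarrow> w a = f a" "\<And>a. a \<notin> {1..n} \<Longrightarrow> f a = a" for f
    using that permutes_not_in[OF w] by (metis ext)
  define q where "q = inv u p"
  have q: "q \<in> {1..n}" using permutes_in_image[OF permutes_inv[OF u]] p by (simp add: q_def)
  have uq: "u q = p" by (simp add: q_def permutes_inverses(1)[OF u])
  define r where "r = inv u q"
  have r: "r \<in> {1..n}" using permutes_in_image[OF permutes_inv[OF u]] q by (simp add: r_def)
  have ur: "u r = q" by (simp add: r_def permutes_inverses(1)[OF u])
  have "p \<noteq> q" using u_neq[OF q] uq by simp
  have "r \<noteq> q" using u_neq[OF q] ur by auto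
  \<comment> \<open>Otherwise \<open>p\<close> and \<open>q\<close> would be the only labels, and
    then there is just one long cycle.\<close>
  have "r \<noteq> p"
  proof
    assume "r = p"
    then have up: "u p = q" using ur by simp
    have "u a \<in> {p, q} \<longleftrightarrow> a \<in> {p, q}" for a
      using up uq u_eq by (metis insert_iff singletonD)
    then have "(a \<in> {p, q}) = (p \<in> {p, q})" if "a \<in> {1..n}" for a
      by (intro long_cycle_invariant_const[OF v(1) _ that p]) (simp add: v(2))
    then have pq: "a = p \<or> a = q" if "a \<in> {1..n}" for a using that by auto
    have "w a = u a" if "a \<in> {1..n}" for a
      using pq[OF that] pq[OF w_in[OF that]] w_neq[OF that] up uq by auto
    then have "w = u" using permutes_not_in[OF u] by (blast intro: eqI)
    then show False using \<open>u \<noteq> w\<close> by simp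
  qed
  have X_in: "X a \<in> Y ` {1..n}" if "a \<in> {1..n}" "a \<noteq> p" for a
    using facet X_eq[OF that(1) p] that by blast
  have Y_X: "Y a = X a" if a: "a \<in> {1..n}" "a \<noteq> p" "a \<noteq> q" for a
  proof -
    \<comment> \<open>The edge of \<open>X\<close> with label \<open>a\<close> avoids
      \<open>X p\<close> exactly when \<open>a\<close> is neither \<open>p\<close> nor its
      predecessor \<open>q\<close>, and then \<open>shared_edge\<close> applies.\<close>
    have "u a \<noteq> p" using a uq u_eq by metis
    then show ?thesis
      using X_in[OF a(1,2)] X_in[OF u_in[OF a(1)]] shared_edge[OF X v'(1) _ a(1)] Y v'(2) by blast
  qed
  have Y_eq: "Y a = Y b \<longleftrightarrow> a = b" if "a \<in> {1..n}" "b \<in> {1..n}" for a b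
    by (rule inj_on_eq_iff[OF labelled_circuit_inj_on[OF v'(1) Y[unfolded v'(2)]] that])
  have Y_next: "Y (w a) = X (u a)" if a: "a \<in> {1..n}" "a \<noteq> p" "a \<noteq> q" for a
    using X Y Y_X[OF a] a(1) by (simp add: labelled_circuit_def)
  have w_u: "w a = u a" if a: "a \<in> {1..n}" "a \<noteq> p" "a \<noteq> q" "a \<noteq> r" for a
  proof -
    \<comment> \<open>Only \<open>q\<close> and \<open>r\<close> are sent to \<open>p\<close> and
      \<open>q\<close>. For other labels \<open>X\<close> and \<open>Y\<close> also agree at
      \<open>u a\<close>, and injectivity of \<open>Y\<close> compares the labels.\<close>
    have "u a \<noteq> p" "u a \<noteq> q" using a uq ur u_eq by metis+
    then have "Y (w a) = Y (u a)"
      using Y_next[OF a(1-3)] Y_X[OF u_in[OF a(1)]] by simp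
    then show ?thesis using Y_eq w_in u_in a(1) by blast
  qed
  define s where "s = u p"
  have s: "s \<in> {1..n}" "s \<noteq> p" "s \<noteq> q"
    using u_in[OF p] u_neq[OF p] ur u_eq \<open>r \<noteq> p\<close> unfolding s_def by metis+
  \<comment> \<open>\<open>w\<close> agrees with \<open>u\<close> off \<open>{r, q, p}\<close>, so it maps this set onto \<open>u ` {r, q, p}\<close>.\<close>
  have w_cases: "w a \<in> {q, p, s}" if a: "a \<in> {r, q, p}" for a
  proof (rule ccontr)
    assume na: "w a \<notin> {q, p, s}"
    define b where "b = inv u (w a)"
    have ub: "u b = w a" by (simp add: b_def permutes_inverses(1)[OF u])
    have "w a \<in> {1..n}" using w_in a p q r by blast
    then have b: "b \<in> {1..n}"
      using permutes_in_image[OF permutes_inv[OF u]] by (simp add: b_def)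
    have "b \<noteq> p" "b \<noteq> q" "b \<noteq> r" using na ub uq ur s_def by auto
    then have "w b = w a" using w_u[OF b] ub by simp
    then show False using w_eq a \<open>b \<noteq> p\<close> \<open>b \<noteq> q\<close> \<open>b \<noteq> r\<close> by auto
  qed
  have Ywr: "Y (w r) = X q"
    using Y_next[OF r \<open>r \<noteq> p\<close> \<open>r \<noteq> q\<close>] ur by simp
  have "w r \<noteq> s"
    using Ywr Y_X[OF s] X_eq[OF s(1) q] s by auto
  \<comment> \<open>Here the absence of fixed points would fill in the remaining values and give
    \<open>w = u\<close>.\<close>
  have "w r \<noteq> q"
  proof
    assume wr: "w r = q"
    have "w p = s" using w_cases[of p] w_neq[OF p] wr w_eq[of p r] \<open>r \<noteq> p\<close> by auto
    moreover have "w q = p"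
      using w_cases[of q] w_neq[OF q] \<open>w p = s\<close> w_eq[of q p] \<open>p \<noteq> q\<close> by auto
    ultimately have "w a = u a" if "a \<in> {1..n}" for a
      using w_u[OF that] wr uq ur s_def by metis
    then have "w = u" using permutes_not_in[OF u] by (blast intro: eqI)
    then show False using \<open>u \<noteq> w\<close> by simp
  qed
  then have wr: "w r = p" using w_cases[of r] \<open>w r \<noteq> s\<close> by auto
  have wq: "w q = s"
    using w_cases[of q] w_neq[OF q] wr w_eq[of q r] \<open>r \<noteq> q\<close> by auto
  have wp: "w p = q"
    using w_cases[of p] w_neq[OF p] wq w_eq[of q p] \<open>p \<noteq> q\<close> by auto
  let ?t = "Transposition.transpose q (u q)"
  have "w = ?t \<circ> u \<circ> ?t"
  proof (rule eqI)
    fix a assume a: "a \<in> {1..n}"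
    consider "a = p" | "a = q" | "a = r" | "a \<noteq> p" "a \<noteq> q" "a \<noteq> r" by blast
    then show "w a = (?t \<circ> u \<circ> ?t) a"
    proof cases
      case 4
      then have "u a \<noteq> p" "u a \<noteq> q" using uq ur u_eq by metis+
      then show ?thesis using 4 w_u[OF a] uq by simp
    qed (use uq ur wp wq wr s s_def \<open>r \<noteq> p\<close> \<open>r \<noteq> q\<close> in simp_all)
  next
    fix a assume "a \<notin> {1..n}"
    then show "(?t \<circ> u \<circ> ?t) a = a"
      using p q uq permutes_not_in[OF u, of a] by (metis comp_apply transpose_apply_other)
  qed
  moreover
  \<comment> \<open>Since \<open>Y p = X q\<close>, both labels can depart from this one vertex: it
    has ones at \<open>p\<close> and \<open>q\<close> and zeros at their successors, so neither
    label succeeds the other.\<close>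
  have "Y p $ e p = 1" "Y p $ e (cyc_next n p) = 0" "X q $ e q = 1" "X q $ e (cyc_next n q) = 0"
    using X Y p q by (auto simp: labelled_circuit_def)
  with Ywr wr have "p \<noteq> cyc_next n q" "q \<noteq> cyc_next n p" by auto
  ultimately show ?thesis using that q uq by metis
qed

text \<open>From \<open>X q\<close> the new circuit takes label \<open>p\<close> first and
  \<open>q\<close> second, meeting \<open>X\<close> again at \<open>X (u p)\<close>. The candidate
  \<open>Z\<close> built in this way is a labelled circuit for \<open>w\<close>, so it equals
  \<open>Y\<close> by uniqueness.\<close>

lemma swap_imp_shared_facet:
  assumes v: "v permutes {1..n}" "u = long_cycle n v" and X: "labelled_circuit e n u X"
    and v': "v' permutes {1..n}" "w = long_cycle n v'" and Y: "labelled_circuit e n w Y"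
    and q: "q \<in> {1..n}" "u q \<noteq> cyc_next n q" "q \<noteq> cyc_next n (u q)"
    and w_swap: "w = Transposition.transpose q (u q) \<circ> u \<circ> Transposition.transpose q (u q)"
  shows "X ` {1..n} - {X (u q)} = Y ` {1..n} - {Y q}" "X ` {1..n} \<noteq> Y ` {1..n}"
proof -
  have u: "u permutes {1..n}"
    using long_cycle_permutes v by auto
  have u_in: "u a \<in> {1..n}" if "a \<in> {1..n}" for a
    using that by (simp only: permutes_in_image[OF u])
  have u_eq: "u a = u b \<longleftrightarrow> a = b" for a b
    by (rule inj_eq[OF permutes_inj[OF u]])
  define p where "p = u q"
  have p: "p \<in> {1..n}" using u_in q by (simp add: p_def)
  have "p \<noteq> q" using long_cycle_neq[OF v(1) two_le q(1)] v by (simp add: p_def)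
  have nb: "p \<noteq> cyc_next n q" "q \<noteq> cyc_next n p" using q by (auto simp: p_def)
  have X_next: "X (u a) = X a + step e n a" and X1: "X a $ e a = 1"
    and X0: "X a $ e (cyc_next n a) = 0" if "a \<in> {1..n}" for a
    using X that by (auto simp: labelled_circuit_def)
  \<comment> \<open>Otherwise \<open>p\<close> and \<open>q\<close> would be the only labels, hence
    cyclic neighbours.\<close>
  have "u p \<noteq> q"
  proof
    assume up: "u p = q"
    have "u a \<in> {p, q} \<longleftrightarrow> a \<in> {p, q}" for a
      using up p_def u_eq by (metis insert_iff singletonD)
    then have "(a \<in> {p, q}) = (p \<in> {p, q})" if "a \<in> {1..n}" for a
      by (intro long_cycle_invariant_const[OF v(1) _ that p]) (simp add: v(2))
    then show False
      using nb cyc_next_in[OF q(1)] cyc_next_neq[OF two_le q(1)] by auto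
  qed
  have "u p \<noteq> p" using u_eq[of p q] \<open>p \<noteq> q\<close> p_def by auto
  define Z where "Z = X(p := X q, q := X q + step e n p)"
  have Z: "Z p = X q" "Z q = X q + step e n p" "a \<noteq> p \<Longrightarrow> a \<noteq> q \<Longrightarrow> Z a = X a" for a
    using \<open>p \<noteq> q\<close> by (auto simp: Z_def)
  have Xp: "X p = X q + step e n q" using X_next[OF q(1)] by (simp add: p_def)
  have "labelled_circuit e n w Z"
    unfolding labelled_circuit_def
  proof (intro ballI conjI)
    fix a assume a: "a \<in> {1..n}"
    consider "a = p" | "a = q" | "a \<noteq> p" "a \<noteq> q" by blast
    note cases = this
    have wa: "w a = Transposition.transpose q p (u (Transposition.transpose q p a))"
      using w_swap by (simp add: p_def)
    show "Z (w a) = Z a + step e n a"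
      using cases
    proof cases
      case 1
      then show ?thesis using wa Z by (simp flip: p_def)
    next
      case 2
      then show ?thesis
        using wa Z \<open>u p \<noteq> p\<close> \<open>u p \<noteq> q\<close> X_next[OF p] Xp by simp
    next
      case 3
      then have "u a \<noteq> p" using u_eq p_def by metis
      then show ?thesis
        using 3 wa Z X_next[OF a] by (cases "u a = q") simp_all
    qed
    \<comment> \<open>The step of one of the labels \<open>p\<close>, \<open>q\<close> leaves the
      coordinates of the other label and of its successor unchanged, because they are distinct and
      not neighbours. So the exchanged edges are admissible.\<close>
    have next_a: "cyc_next n a \<in> {1..n}" by (rule cyc_next_in[OF a])
    show "Z a $ e a = 1"
      using cases
    proof cases
      case 1
      then show ?thesis using X1[OF p] Xp step_nth[OF q(1) p] nb \<open>p \<noteq> q\<close> Z by simp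
    next
      case 2
      then show ?thesis using X1[OF q(1)] step_nth[OF p q(1)] nb \<open>p \<noteq> q\<close> Z by simp
    next
      case 3
      then show ?thesis using X1[OF a] Z by simp
    qed
    show "Z a $ e (cyc_next n a) = 0"
      using cases
    proof cases
      case 1
      then show ?thesis
        using X0[OF p] Xp step_nth[OF q(1) next_a] nb \<open>p \<noteq> q\<close> Z cyc_next_eq_iff[OF q(1) p] by simp
    next
      case 2
      then show ?thesis
        using X0[OF q(1)] step_nth[OF p next_a] nb \<open>p \<noteq> q\<close> Z cyc_next_eq_iff[OF p q(1)] by simp
    next
      case 3
      then show ?thesis using X0[OF a] Z by simp
    qed
  qed
  then have Y_Z: "Y a = Z a" if "a \<in> {1..n}" for a
    using labelled_circuit_unique[OF v'(1) _ _ that] Y v'(2) by blast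
  have X_eq: "X a = X b \<longleftrightarrow> a = b" if "a \<in> {1..n}" "b \<in> {1..n}" for a b
    by (rule inj_on_eq_iff[OF labelled_circuit_inj_on[OF v(1) X[unfolded v(2)]] that])
  have Y_eq: "Y a = Y b \<longleftrightarrow> a = b" if "a \<in> {1..n}" "b \<in> {1..n}" for a b
    by (rule inj_on_eq_iff[OF labelled_circuit_inj_on[OF v'(1) Y[unfolded v'(2)]] that])
  have "X ` {1..n} - {X p} = X ` ({1..n} - {p})"
    using X_eq p by blast
  also have "{1..n} - {p} = insert q ({1..n} - {p, q})"
    using q(1) \<open>p \<noteq> q\<close> by blast
  \<comment> \<open>The vertex \<open>X q\<close> carries label \<open>q\<close> in \<open>X\<close>
    but label \<open>p\<close> in \<open>Y\<close>; the other common vertices keep their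
    labels.\<close>
  also have "X ` insert q ({1..n} - {p, q}) = insert (Y p) (Y ` ({1..n} - {p, q}))"
    using Y_Z Z p by (auto simp: image_def simp del: atLeastAtMost_iff)
  also have "\<dots> = Y ` insert p ({1..n} - {p, q})" by simp
  also have "insert p ({1..n} - {p, q}) = {1..n} - {q}"
    using p \<open>p \<noteq> q\<close> by blast
  also have "Y ` ({1..n} - {q}) = Y ` {1..n} - {Y q}"
    using Y_eq q(1) by blast
  finally show eq: "X ` {1..n} - {X (u q)} = Y ` {1..n} - {Y q}" by (simp flip: p_def)
  \<comment> \<open>The two vertices lying between the exchanged labels differ at coordinate
    \<open>q\<close>, which only the step of \<open>q\<close> lowers.\<close>
  have "step e n p $ e q \<noteq> step e n q $ e q"
    unfolding step_nth[OF p q(1)] step_nth[OF q(1,1)]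
    using nb \<open>p \<noteq> q\<close> cyc_next_neq[OF two_le q(1)] by simp
  then have "Y q \<noteq> X p" using Y_Z[OF q(1)] Z(2) Xp by auto
  then show "X ` {1..n} \<noteq> Y ` {1..n}" using eq p q(1) unfolding p_def by blast
qed

end

section \<open>Simplices and facets in terms of vertex sets\<close>

lemma convex_hull_eq_iff_affine_independent:
  fixes S T :: "'a::euclidean_space set"
  assumes "\<not> affine_dependent S" "\<not> affine_dependent T"
  shows "convex hull S = convex hull T \<longleftrightarrow> S = T"
  using extreme_point_of_convex_hull_affine_independent[OF assms(1)]
    extreme_point_of_convex_hull_affine_independent[OF assms(2)] by auto

text \<open>Facets of a simplex are the nonempty hulls of all vertices but one, and a simplex
  determines its vertices.\<close>

lemma share_common_facet_simplices:
  fixes S T :: "'a::euclidean_space set"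
  assumes S: "\<not> affine_dependent S" "2 \<le> card S" and T: "\<not> affine_dependent T"
  shows "share_common_facet (convex hull S) (convex hull T) \<longleftrightarrow>
    S \<noteq> T \<and> (\<exists>x\<in>S. \<exists>y\<in>T. S - {x} = T - {y})"
proof -
  have "\<not> affine_dependent (S - {x})" "\<not> affine_dependent (T - {y})" for x y
    using S T affine_dependent_subset by (metis Diff_subset)+
  note faces = convex_hull_eq_iff_affine_independent[OF this]
  \<comment> \<open>A facet is nonempty by definition; the bound on \<open>card S\<close> ensures
    this.\<close>
  have "S - {x} \<noteq> {}" for x
    using S(2) card_mono[of "{x}" S] by auto
  then show ?thesis
    unfolding share_common_facet_def convex_hull_eq_iff_affine_independent[OF S(1) T]
      facet_of_convex_hull_affine_independent[OF S(1)] facet_of_convex_hull_affine_independent[OF T]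
    using faces by (metis convex_hull_eq_empty)
qed

theorem theorem2p9:
  fixes e :: "nat \<Rightarrow> 'n::finite" and k n :: nat and u w :: "nat \<Rightarrow> nat"
  assumes "bij_betw e {1..n} UNIV"
    and "0 < k" and "k < n"
    and "u \<in> C_set k n" and "w \<in> C_set k n"
  shows "share_common_facet (Delta e k n u) (Delta e k n w) \<longleftrightarrow>
    (\<exists>v. v permutes {1..n} \<and> long_cycle n v = u \<and>
      (\<exists>i\<in>{1..n}.
         \<not> [int (v i) - int (v (cyc_next n i)) = 1] (mod int n) \<and>
         \<not> [int (v i) - int (v (cyc_next n i)) = - 1] (mod int n) \<and>
         w = Transposition.transpose (v i) (v (cyc_next n i)) \<circ> u \<circ>
             Transposition.transpose (v i) (v (cyc_next n i))))"
    (is "_ \<longleftrightarrow> ?swap")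
proof -
  interpret numbered_coordinates e n
    by unfold_locales (use assms in auto)
  obtain v X where v: "v permutes {1..n}" "u = long_cycle n v" and X: "labelled_circuit e n u X"
    and Delta_u: "Delta e k n u = convex hull (X ` {1..n})"
    using Delta_eq_hull_labelled_circuit[OF assms(4,2)] .
  obtain v' Y where v': "v' permutes {1..n}" "w = long_cycle n v'" and Y: "labelled_circuit e n w Y"
    and Delta_w: "Delta e k n w = convex hull (Y ` {1..n})"
    using Delta_eq_hull_labelled_circuit[OF assms(5,2)] .
  have indep: "\<not> affine_dependent (X ` {1..n})" "\<not> affine_dependent (Y ` {1..n})"
    using labelled_circuit_affine_independent v v' X Y by blast+
  have "card (X ` {1..n}) = n"
    using card_image[OF labelled_circuit_inj_on[OF v(1)]] X v(2) by simp
  then have share: "share_common_facet (Delta e k n u) (Delta e k n w) \<longleftrightarrow>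
      X ` {1..n} \<noteq> Y ` {1..n} \<and> (\<exists>x\<in>X ` {1..n}. \<exists>y\<in>Y ` {1..n}. X ` {1..n} - {x} = Y ` {1..n} - {y})"
    unfolding Delta_u Delta_w using two_le by (intro share_common_facet_simplices indep) simp
  show ?thesis
  proof
    assume shared: "share_common_facet (Delta e k n u) (Delta e k n w)"
    then obtain p y where p: "p \<in> {1..n}" "X ` {1..n} - {X p} = Y ` {1..n} - {y}"
      unfolding share by blast
    \<comment> \<open>A simplex does not share a facet with itself.\<close>
    have "u \<noteq> w" using shared by (auto simp: share_common_facet_def)
    then obtain a where a: "a \<in> {1..n}" "u a \<noteq> cyc_next n a" "a \<noteq> cyc_next n (u a)"
      "w = Transposition.transpose a (u a) \<circ> u \<circ> Transposition.transpose a (u a)"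
      using shared_facet_imp_swap[OF v X v' Y _ p] by blast
    \<comment> \<open>Any representative of \<open>u\<close> will do; \<open>i\<close> is the
      position of the label \<open>a\<close> in it.\<close>
    define i where "i = inv v a"
    have i: "i \<in> {1..n}" using permutes_in_image[OF permutes_inv[OF v(1)]] a by (simp add: i_def)
    have vi: "v i = a" by (simp add: i_def permutes_inverses(1)[OF v(1)])
    have vi': "v (cyc_next n i) = u a" using long_cycle_apply[OF v(1) i] vi v(2) by simp
    have ua: "u a \<in> {1..n}"
      using permutes_in_image[OF long_cycle_permutes[OF v(1)]] v(2) a by simp
    show ?swap
      using v i a vi vi' cong_one_iff_cyc_next[OF a(1) ua] cong_minus_one_iff_cyc_next[OF a(1) ua]
      by (metis (no_types, lifting))
  next
    assume ?swap
    then obtain v1 i where v1: "v1 permutes {1..n}" "u = long_cycle n v1" and i: "i \<in> {1..n}"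
      and ncong: "\<not> [int (v1 i) - int (v1 (cyc_next n i)) = 1] (mod int n)"
        "\<not> [int (v1 i) - int (v1 (cyc_next n i)) = - 1] (mod int n)"
      and w: "w = Transposition.transpose (v1 i) (v1 (cyc_next n i)) \<circ> u \<circ>
             Transposition.transpose (v1 i) (v1 (cyc_next n i))"
      by auto
    define q where "q = v1 i"
    have q: "q \<in> {1..n}" using permutes_in_image[OF v1(1)] i by (simp add: q_def)
    have uq: "v1 (cyc_next n i) = u q" using long_cycle_apply[OF v1(1) i] v1(2) by (simp add: q_def)
    have uq_in: "u q \<in> {1..n}"
      using permutes_in_image[OF long_cycle_permutes[OF v(1)]] v(2) q by simp
    have "u q \<noteq> cyc_next n q" "q \<noteq> cyc_next n (u q)"
      using ncong cong_one_iff_cyc_next[OF q uq_in] cong_minus_one_iff_cyc_next[OF q uq_in]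
      unfolding uq q_def[symmetric] by auto
    from swap_imp_shared_facet[OF v X v' Y q this] w
    show "share_common_facet (Delta e k n u) (Delta e k n w)"
      unfolding share uq q_def[symmetric] using q uq_in by blast
  qed
qed

end
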